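(* Suppose the nondegeneracy assumption holds: $\operatorname{rank}(C)=N_2$ and $|\operatorname{supp}(s_i)|=N_2$ for every extreme point $s_i\in\mathcal S$ of the dual polyhedron $\mathcal Z$. Let $x_1^*$ be an optimal first-stage decision, and let $\mathcal J_i=\operatorname{supp}(s_i)$ for each $s_i\in\mathcal S$. Then the optimal second-stage decision rule is $$x_2(\xi)=C_{\mathcal J_i}^{-1}\,d_{\mathcal J_i}(\xi,x_1^* ),\qquad i=i^{\mathcal S}_{x_1^*}(\xi),\qquad \xi\in\Xi;$$ that is, for every $\xi\in\Xi$ this $x_2(\xi)$ is feasible and optimal for the second-stage problem $\min_{x_2}\{b^\top x_2\mid Cx_2\ge d(\xi,x_1^* )\}$.
   Context: Setting. $\Xi\subseteq\mathbb R^{N_\xi}$ is a compact uncertainty set, $C\in\mathbb R^{M\times N_2}$ with $M\ge N_2$, $b\in\mathbb R^{N_2}$, and $B,W,w,A,a,c$ are fixed data of compatible dimensions; $x_1\in\mathbb R^{N_1}$ and $x_2\in\mathbb R^{N_2}$. Put $d(\xi,x_1)=W\xi+w-Bx_1\in\mathbb R^M$. The second-stage (recourse) value is $\psi(x_1,\xi)=\min_{x_2}\{b^\top x_2\mid Cx_2\ge d(\xi,x_1)\}$. The dual polyhedron $\mathcal Z=\{z\in\mathbb R^M\mid C^\top z=b,\ z\ge 0\}$ is assumed nonempty; $\mathcal S=\{s_1,\dots,s_S\}$ is its finite set of extreme points, and $\mathcal R$ is the finite set of extreme rays of its recession cone $\{r\mid C^\top r=0,\ r\ge0\}$. The first-stage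 feasible region is $$\mathcal X_1=\{x_1: Ax_1\ge a,\ \sup_{\xi\in\Xi}d(\xi,x_1)^\top r\le 0\ \ \forall r\in\mathcal R\}.$$ For $x_1\in\mathcal X_1$, $\psi(x_1,\xi)=\max_{s\in\mathcal S}d(\xi,x_1)^\top s$ for all $\xi\in\Xi$. The full master problem is $$\min_{x_1,\theta}\ c^\top x_1+\phi_0(\theta)\quad\text{s.t.}\quad \phi_\ell(\theta,\xi)\ge d(\xi,x_1)^\top s\ \ \forall\xi\in\Xi,\ s\in\mathcal S,\ \ell\in[L],\quad x_1\in\mathcal X_1,\ \theta\in\Theta,$$ where $\Theta\subseteq\mathbb R^{N_\theta}$, $\phi_0:\Theta\to\mathbb R$ and $\phi_\ell:\Theta\times\Xi\to\mathbb R$ ($\ell\in[L]$) are given; it is an exact (ambiguity-dual epigraph) reformulation of the two-stage distributionally robust problem $\min_{x_1:Ax_1\ge a}c^\top x_1+\sup_{\mathbb P\in\mathcal P}\mathbb E_{\mathbb P}[\psi(x_1,\xi)]$. It is assumed to have a finite optimal value and to attain it. An optimal first-stage decision is the $x_1$-component of an optimal solution of the full master; in particular it lies in $\mathcal X_1$. Notation. $\operatorname{supp}(v)$ is the index set of nonzero components of $v$. For an index set $\mathcal J\subseteq[M]$, $v_{\mathcal J}$ is the corresponding subvector and $C_{\mathcal J}$ the submatrix of rows of $C$ indexed by $\mathcal J$. For nonempty $\mathcal T\subseteq\mathcal S$ the selector is $i^{\mathcal T}_{x_1}(\xi)=\min\arg\max_{j:\,s_j\in\mathcal T}d(\xi,x_1)^\top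 s_j$ (the smallest maximizing index). *)

theory Defs
  imports "HOL-Analysis.Analysis"
begin

definition dual_polyhedron :: "real^'n^'m \<Rightarrow> real^'n \<Rightarrow> (real^'m) set" where
  "dual_polyhedron C b = {z. transpose C *v z = b \<and> 0 \<le> z}"

definition recession_cone :: "real^'n^'m \<Rightarrow> (real^'m) set" where
  "recession_cone C = {r. transpose C *v r = 0 \<and> 0 \<le> r}"

definition ray :: "'a::real_vector \<Rightarrow> 'a set" where
  "ray r = {t *\<^sub>R r | t. 0 \<le> t}"

definition extreme_rays :: "'a::real_vector set \<Rightarrow> 'a set set" where
  "extreme_rays K = {F. F face_of K \<and> (\<exists>r. r \<noteq> 0 \<and> F = ray r)}"

text \<open>A set of vectors containing exactly one generator of each extreme ray. Generators are only
  determined up to a positive factor.\<close>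

definition extreme_ray_generators :: "'a::real_vector set \<Rightarrow> 'a set \<Rightarrow> bool" where
  "extreme_ray_generators K R \<longleftrightarrow> finite R \<and> bij_betw ray R (extreme_rays K)"

definition rhs ::
  "real^'k^'m \<Rightarrow> real^'m \<Rightarrow> real^'p^'m \<Rightarrow> real^'k \<Rightarrow> real^'p \<Rightarrow> real^'m" where
  "rhs W w B \<xi> x1 = W *v \<xi> + w - B *v x1"

text \<open>The supremum is taken in the extended reals, so that it is \<open>-\<infinity>\<close> for empty \<open>\<Xi>\<close>.\<close>

definition first_stage_feasible ::
  "(real^'k) set \<Rightarrow> (real^'m) set \<Rightarrow> real^'p^'q \<Rightarrow> real^'q \<Rightarrow> real^'k^'m \<Rightarrow> real^'m \<Rightarrow> real^'p^'m
    \<Rightarrow> (real^'p) set" where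
  "first_stage_feasible \<Xi> R A a W w B =
     {x1. a \<le> A *v x1 \<and> (\<forall>r\<in>R. (SUP \<xi>\<in>\<Xi>. ereal (rhs W w B \<xi> x1 \<bullet> r)) \<le> 0)}"

definition master_feasible ::
  "(real^'k) set \<Rightarrow> (real^'m) set \<Rightarrow> (real^'m) set \<Rightarrow> real^'p^'q \<Rightarrow> real^'q
    \<Rightarrow> real^'k^'m \<Rightarrow> real^'m \<Rightarrow> real^'p^'m
    \<Rightarrow> (real^'t) set \<Rightarrow> nat \<Rightarrow> (nat \<Rightarrow> real^'t \<Rightarrow> real^'k \<Rightarrow> real)
    \<Rightarrow> ((real^'p) \<times> (real^'t)) set" where
  "master_feasible \<Xi> S R A a W w B \<Theta> L \<phi> =
     {(x1, \<theta>). x1 \<in> first_stage_feasible \<Xi> R A a W w B \<and> \<theta> \<in> \<Theta> \<and>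
        (\<forall>\<xi>\<in>\<Xi>. \<forall>s\<in>S. \<forall>l\<in>{1..L}. rhs W w B \<xi> x1 \<bullet> s \<le> \<phi> l \<theta> \<xi>)}"

definition master_objective ::
  "real^'p \<Rightarrow> (real^'t \<Rightarrow> real) \<Rightarrow> (real^'p) \<times> (real^'t) \<Rightarrow> real" where
  "master_objective c \<phi>0 = (\<lambda>(x1, \<theta>). c \<bullet> x1 + \<phi>0 \<theta>)"

definition supp :: "real^'m \<Rightarrow> 'm set" where
  "supp v = {j. v $ j \<noteq> 0}"

text \<open>To form the square matrix \<open>C\<^sub>J\<close> of type \<^typ>\<open>real^'n^'n\<close> and the vector \<open>d\<^sub>J\<close> from an
  index set \<open>J\<close> of cardinality \<open>CARD('n)\<close>, the elements of \<open>J\<close> are listed in an arbitrary but fixed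
  order. The vector \<open>C\<^sub>J\<inverse> d\<^sub>J\<close> does not depend on that order, see
  \<open>basic_solution_order_indep\<close> below.\<close>

definition enum_of :: "'m set \<Rightarrow> 'n::finite \<Rightarrow> 'm" where
  "enum_of J = (SOME e. bij_betw e UNIV J)"

definition subvector :: "'m set \<Rightarrow> real^'m \<Rightarrow> real^'n" where
  "subvector J v = (\<chi> i. v $ enum_of J i)"

definition row_submatrix :: "'m set \<Rightarrow> real^'n^'m \<Rightarrow> real^'n^'n" where
  "row_submatrix J C = (\<chi> i. C $ enum_of J i)"

lemma bij_betw_enum_of:
  fixes J :: "'m::finite set"
  assumes "card J = CARD('n)"
  shows "bij_betw (enum_of J :: 'n::finite \<Rightarrow> 'm) UNIV J"
proof -
  have "\<exists>e :: 'n \<Rightarrow> 'm. bij_betw e UNIV J"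
    using assms by (metis finite finite_same_card_bij)
  then show ?thesis
    unfolding enum_of_def by (rule someI_ex)
qed

lemma matrix_inv_mult_eq_iff:
  fixes D :: "real^'n^'n"
  assumes "invertible D"
  shows "x = matrix_inv D *v y \<longleftrightarrow> D *v x = y"
proof -
  have "\<exists>D'. D ** D' = mat 1 \<and> D' ** D = mat 1"
    using assms by (simp add: invertible_def)
  then have "D ** matrix_inv D = mat 1 \<and> matrix_inv D ** D = mat 1"
    unfolding matrix_inv_def by (rule someI_ex)
  then show ?thesis
    by (metis matrix_vector_mul_assoc matrix_vector_mul_lid)
qed

lemma basic_solution_order_indep:
  fixes C :: "real^'n^'m" and e :: "'n \<Rightarrow> 'm"
  assumes e: "bij_betw e UNIV J" and inv: "invertible (row_submatrix J C)"
  shows "invertible (\<chi> i. C $ e i) \<and>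
    matrix_inv (\<chi> i. C $ e i) *v (\<chi> i. d $ e i) =
    matrix_inv (row_submatrix J C) *v subvector J d"
proof -
  define f where "f = (enum_of J :: 'n \<Rightarrow> 'm)"
  have f: "bij_betw f UNIV J"
    using bij_betw_same_card[OF e] unfolding f_def by (intro bij_betw_enum_of) simp
  have solve: "(\<chi> i. C $ g i) *v x = (\<chi> i. v $ g i) \<longleftrightarrow> (\<forall>j\<in>J. (C *v x) $ j = v $ j)"
    if "bij_betw g UNIV J" for g :: "'n \<Rightarrow> 'm" and x v
  proof -
    have "J = range g"
      using that by (simp add: bij_betw_def)
    then show ?thesis
      by (auto simp: vec_eq_iff matrix_vector_mult_def)
  qed
  have D: "row_submatrix J C = (\<chi> i. C $ f i)" "subvector J d = (\<chi> i. d $ f i)"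
    by (simp_all add: row_submatrix_def subvector_def f_def)
  have "x = 0" if "(\<chi> i. C $ e i) *v x = 0" for x
  proof -
    have "(\<chi> i. C $ f i) *v x = 0"
      using that solve[OF e, of x 0] solve[OF f, of x 0] by (simp add: zero_vec_def)
    then show "x = 0"
      using inv D(1) by (metis matrix_inv_mult_eq_iff matrix_vector_mult_0_right)
  qed
  then have inv': "invertible (\<chi> i. C $ e i)"
    by (metis invertible_left_inverse matrix_left_invertible_ker)
  show ?thesis
    using inv' matrix_inv_mult_eq_iff[OF inv'] matrix_inv_mult_eq_iff[OF inv]
      solve[OF e, of _ d] solve[OF f, of _ d] unfolding D by metis
qed

text \<open>The smallest index in \<open>{1..n}\<close> that maximizes \<open>d \<bullet> s j\<close> among the \<open>j\<close> with \<open>s j \<in> T\<close>.\<close>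

definition selector :: "(nat \<Rightarrow> real^'m) \<Rightarrow> nat \<Rightarrow> (real^'m) set \<Rightarrow> real^'m \<Rightarrow> nat" where
  "selector s n T d = (LEAST i. is_arg_max (\<lambda>j. d \<bullet> s j) (\<lambda>j. j \<in> {1..n} \<and> s j \<in> T) i)"

end

theory Submission
  imports Defs
begin

text \<open>
  The proof is the optimality test of the simplex method, run on the dual program
  \<open>max {d \<bullet> z | z \<in> Z}\<close> over the dual polyhedron \<open>Z\<close>. Let \<open>s\<close> be the selected extreme
  point, \<open>J\<close> its support, and \<open>x\<close> the solution of \<open>C\<^sub>J x = d\<^sub>J\<close>.

  A point of \<open>Z\<close> is extreme exactly if the rows of \<open>C\<close> indexed by its support are linearly
  independent (\<open>extreme_point_iff_independent_rows\<close>). As \<open>J\<close> has as many elements as \<open>C\<close> has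
  columns, \<open>C\<^sub>J\<close> is invertible and \<open>x\<close> is well defined. Since \<open>s\<close> vanishes off \<open>J\<close>, the vectors
  \<open>x\<close> and \<open>s\<close> are complementary, so weak duality makes \<open>x\<close> optimal as soon as it is feasible
  (\<open>complementary_imp_optimal\<close>).

  Feasibility (\<open>basic_solution_feasible\<close>) is where the maximality of \<open>s\<close> and the first-stage
  constraints enter. If the constraint of a row \<open>k\<close> is violated, then \<open>k \<notin> J\<close>, and there is an edge
  direction \<open>u\<close> of \<open>Z\<close> at \<open>s\<close>, with entry \<open>1\<close> at \<open>k\<close> and otherwise supported in \<open>J\<close>, along which
  \<open>d \<bullet> z\<close> strictly increases. Either \<open>u \<ge> 0\<close>; then \<open>u\<close> spans an extreme ray of the recession cone,
  and the first-stage constraints say \<open>d \<bullet> u \<le> 0\<close>. Or the edge ends, after a step of positive length,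
  in another extreme point of \<open>Z\<close>, which has a larger value than \<open>s\<close>. Both are impossible.

  What remains is that the selector has something to select: \<open>Z\<close> has an extreme point, namely any
  point whose support has the fewest elements (\<open>extreme_point_exists\<close>).
\<close>

section \<open>Supports and the ratio test\<close>

lemma nth_nonneg: "0 \<le> z $ j" if "(0::real^'m) \<le> z"
  using that by (simp add: less_eq_vec_def)

lemma supp_subset_of_open_segment:
  fixes x y z :: "real^'m"
  assumes "0 \<le> y" "0 \<le> z" "x \<in> open_segment y z"
  shows "supp y \<subseteq> supp x" "supp z \<subseteq> supp x"
proof -
  obtain r where r: "0 < r" "r < 1" "x = (1 - r) *\<^sub>R y + r *\<^sub>R z"
    using assms(3) by (auto simp: in_segment)
  have "y $ j = 0 \<and> z $ j = 0" if "x $ j = 0" for j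
  proof -
    have "(1 - r) * y $ j + r * z $ j = 0"
      using that r(3) by simp
    moreover have "0 \<le> (1 - r) * y $ j" "0 \<le> r * z $ j"
      using r nth_nonneg[OF assms(1)] nth_nonneg[OF assms(2)] by simp_all
    ultimately have "(1 - r) * y $ j = 0" "r * z $ j = 0"
      by linarith+
    then show ?thesis
      using r by simp
  qed
  then show "supp y \<subseteq> supp x" "supp z \<subseteq> supp x"
    by (auto simp: supp_def)
qed

text \<open>The step length is the smallest of the ratios \<open>z\<^sub>j / -u\<^sub>j\<close> over the decreasing coordinates
  \<open>j\<close>, and the returned index attains it.\<close>

lemma ratio_test:
  fixes z u :: "real^'m"
  assumes "0 \<le> z" "\<not> 0 \<le> u"
  obtains t j where "0 \<le> t" "0 \<le> z + t *\<^sub>R u" "u $ j < 0" "(z + t *\<^sub>R u) $ j = 0"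
proof -
  define N where "N = {j. u $ j < 0}"
  define q where "q = (\<lambda>j. z $ j / - (u $ j))"
  have "N \<noteq> {}"
    using assms(2) by (auto simp: N_def less_eq_vec_def not_le)
  then obtain j where j: "j \<in> N" "\<And>i. i \<in> N \<Longrightarrow> q j \<le> q i"
    using arg_min_if_finite[of N q] by (metis finite linorder_not_le)
  have q0: "0 \<le> q j"
    using j(1) nth_nonneg[OF assms(1)] unfolding q_def N_def
    by (intro divide_nonneg_nonneg) auto
  have "0 \<le> z $ i + q j * u $ i" for i
  proof (cases "i \<in> N")
    case True
    then have "q j * - (u $ i) \<le> q i * - (u $ i)"
      using j(2) by (intro mult_right_mono) (auto simp: N_def)
    then show ?thesis
      using True by (simp add: q_def N_def)
  next
    case False
    then show ?thesis
      using q0 nth_nonneg[OF assms(1)] by (simp add: N_def)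
  qed
  then have "0 \<le> z + q j *\<^sub>R u"
    by (simp add: less_eq_vec_def)
  moreover have "(z + q j *\<^sub>R u) $ j = 0"
    using j(1) by (simp add: q_def N_def)
  ultimately show thesis
    using that q0 j(1) by (simp add: N_def)
qed

lemma exists_positive_step:
  fixes z u :: "real^'m"
  assumes "0 \<le> z" "\<And>j. u $ j < 0 \<Longrightarrow> z $ j \<noteq> 0"
  obtains t where "0 < t" "0 \<le> z + t *\<^sub>R u"
proof (cases "0 \<le> u")
  case True
  then have "0 \<le> z + 1 *\<^sub>R u"
    using assms(1) by (simp add: less_eq_vec_def)
  then show thesis
    using that zero_less_one by blast
next
  case False
  then obtain t j where t: "0 \<le> t" "0 \<le> z + t *\<^sub>R u" "u $ j < 0" "(z + t *\<^sub>R u) $ j = 0"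
    using ratio_test assms(1) by blast
  then have "t \<noteq> 0"
    using assms(2) by auto
  then show thesis
    using that t(1,2) by (metis less_eq_real_def)
qed

section \<open>Extreme points of the dual polyhedron\<close>

text \<open>Linear independence of the family of rows of \<open>C\<close> indexed by \<open>J\<close>. It refers to the family and
  not to the set of rows, so that a repeated row counts as a dependence; coefficient vectors
  are taken in the full space, with zeros outside \<open>J\<close>.\<close>

definition independent_rows :: "real^'n^'m \<Rightarrow> 'm set \<Rightarrow> bool" where
  "independent_rows C J \<longleftrightarrow> (\<forall>u. transpose C *v u = 0 \<and> supp u \<subseteq> J \<longrightarrow> u = 0)"

lemma transpose_mult_uminus: "transpose C *v (- u) = - (transpose C *v u)" for C :: "real^'n^'m"
  by (rule linear_neg[OF matrix_vector_mul_linear])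

lemma dual_polyhedron_step:
  assumes "z \<in> dual_polyhedron C b" "transpose C *v u = 0" "0 \<le> z + t *\<^sub>R u"
  shows "z + t *\<^sub>R u \<in> dual_polyhedron C b"
  using assms by (simp add: dual_polyhedron_def matrix_vector_right_distrib
      matrix_vector_mult_scaleR del: transpose_matrix_vector)

text \<open>A dependence \<open>u\<close> among the rows in the support of \<open>z\<close> allows \<open>z\<close> to move a little along both
  \<open>u\<close> and \<open>-u\<close>; conversely the end points of a segment around \<open>z\<close> are supported where \<open>z\<close> is, and
  their difference is a dependence.\<close>

lemma extreme_point_iff_independent_rows:
  fixes C :: "real^'n^'m"
  assumes z: "z \<in> dual_polyhedron C b"
  shows "z extreme_point_of dual_polyhedron C b \<longleftrightarrow> independent_rows C (supp z)"
proof
  assume ext: "z extreme_point_of dual_polyhedron C b"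
  have z0: "0 \<le> z"
    using z by (simp add: dual_polyhedron_def)
  have "u = 0" if ker: "transpose C *v u = 0" and sub: "supp u \<subseteq> supp z" for u
  proof (rule ccontr)
    assume "u \<noteq> 0"
    have nz: "z $ j \<noteq> 0" if "u $ j \<noteq> 0" for j
      using sub that by (auto simp: supp_def)
    obtain t where t: "0 < t" "0 \<le> z + t *\<^sub>R u"
      using exists_positive_step[OF z0, of u] nz by (metis less_irrefl)
    obtain t' where t': "0 < t'" "0 \<le> z + t' *\<^sub>R (- u)"
      using exists_positive_step[OF z0, of "- u"] nz
      by (metis neg_less_0_iff_less less_irrefl vector_uminus_component)
    define y y' where "y = z + t *\<^sub>R u" and "y' = z + t' *\<^sub>R (- u)"
    have "y \<in> dual_polyhedron C b"
      unfolding y_def using z ker t(2) by (rule dual_polyhedron_step)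
    moreover have "y' \<in> dual_polyhedron C b"
      unfolding y'_def using z _ t'(2) by (rule dual_polyhedron_step)
        (use ker in \<open>simp add: transpose_mult_uminus del: transpose_matrix_vector\<close>)
    moreover have "z \<in> open_segment y' y"
    proof -
      define r where "r = t' / (t + t')"
      have "0 < r" "r < 1"
        using t(1) t'(1) by (simp_all add: r_def)
      moreover have "r * t - (1 - r) * t' = 0"
        using t(1) t'(1) by (simp add: r_def field_simps)
      then have "(r * t - (1 - r) * t') *\<^sub>R u = 0"
        by simp
      then have "z = (1 - r) *\<^sub>R y' + r *\<^sub>R y"
        by (simp add: y_def y'_def algebra_simps)
      moreover have "y - y' = (t + t') *\<^sub>R u"
        by (simp add: y_def y'_def algebra_simps)
      then have "y' \<noteq> y"
        using t(1) t'(1) \<open>u \<noteq> 0\<close> by auto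
      ultimately show ?thesis
        unfolding in_segment by blast
    qed
    ultimately show False
      using ext by (auto simp: extreme_point_of_def)
  qed
  then show "independent_rows C (supp z)"
    by (simp add: independent_rows_def)
next
  assume ind: "independent_rows C (supp z)"
  have "z \<notin> open_segment y y'"
    if y: "y \<in> dual_polyhedron C b" and y': "y' \<in> dual_polyhedron C b" for y y'
  proof
    assume seg: "z \<in> open_segment y y'"
    have "supp y \<subseteq> supp z" "supp y' \<subseteq> supp z"
      using supp_subset_of_open_segment[OF _ _ seg] y y' by (auto simp: dual_polyhedron_def)
    then have "supp (y - y') \<subseteq> supp z"
      by (force simp: supp_def)
    moreover have "transpose C *v (y - y') = 0"
      using y y' by (simp add: dual_polyhedron_def matrix_vector_mult_diff_distrib
          del: transpose_matrix_vector)
    ultimately have "y - y' = 0"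
      using ind unfolding independent_rows_def by blast
    then show False
      using seg by simp
  qed
  then show "z extreme_point_of dual_polyhedron C b"
    using z by (auto simp: extreme_point_of_def)
qed

text \<open>At a point of minimal support the rows are independent: moving along a dependence until the
  first coordinate vanishes would shrink the support.\<close>

lemma extreme_point_exists:
  fixes C :: "real^'n^'m"
  assumes "dual_polyhedron C b \<noteq> {}"
  obtains z where "z extreme_point_of dual_polyhedron C b"
proof -
  obtain z0 where "z0 \<in> dual_polyhedron C b"
    using assms by blast
  then obtain z where z: "z \<in> dual_polyhedron C b"
    and min: "\<And>y. y \<in> dual_polyhedron C b \<Longrightarrow> card (supp z) \<le> card (supp y)"
    using ex_has_least_nat[of "\<lambda>y. y \<in> dual_polyhedron C b" z0 "\<lambda>y. card (supp y)"] by blast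
  have no_descent: "0 \<le> u" if ker: "transpose C *v u = 0" and sub: "supp u \<subseteq> supp z" for u
  proof (rule ccontr)
    assume "\<not> 0 \<le> u"
    moreover have "0 \<le> z"
      using z by (simp add: dual_polyhedron_def)
    ultimately obtain t j where t: "0 \<le> z + t *\<^sub>R u" "u $ j < 0" "(z + t *\<^sub>R u) $ j = 0"
      using ratio_test by blast
    have "supp (z + t *\<^sub>R u) \<subset> supp z"
    proof
      show "supp (z + t *\<^sub>R u) \<subseteq> supp z"
        using sub by (force simp: supp_def)
      have "j \<in> supp u" "j \<notin> supp (z + t *\<^sub>R u)"
        using t(2,3) by (simp_all add: supp_def)
      then show "supp (z + t *\<^sub>R u) \<noteq> supp z"
        using sub by blast
    qed
    then have "card (supp (z + t *\<^sub>R u)) < card (supp z)"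
      by (simp add: psubset_card_mono)
    then show False
      using min dual_polyhedron_step[OF z ker t(1)] by (simp add: leD)
  qed
  have "u = 0" if "transpose C *v u = 0" "supp u \<subseteq> supp z" for u
  proof -
    have "transpose C *v (- u) = 0" "supp (- u) \<subseteq> supp z"
      using that by (simp_all add: transpose_mult_uminus supp_def del: transpose_matrix_vector)
    then have "0 \<le> u" "0 \<le> - u"
      using that no_descent by blast+
    then show ?thesis
      by (simp add: vec_eq_iff less_eq_vec_def order_antisym)
  qed
  then show thesis
    using that extreme_point_iff_independent_rows[OF z] unfolding independent_rows_def by blast
qed

section \<open>Bases and edge directions\<close>

text \<open>A coefficient vector for the rows of the square matrix \<open>C\<^sub>J\<close>, extended by zero to a
  coefficient vector for all rows of \<open>C\<close>.\<close>

definition zero_extension :: "'m set \<Rightarrow> real^'n \<Rightarrow> real^'m" where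
  "zero_extension J v = (\<chi> j. if j \<in> J then v $ inv_into UNIV (enum_of J) j else 0)"

lemma supp_zero_extension: "supp (zero_extension J v) \<subseteq> J"
  by (auto simp: supp_def zero_extension_def)

lemma zero_extension_nth_enum_of:
  fixes v :: "real^'n" and J :: "'m::finite set"
  assumes "card J = CARD('n)"
  shows "zero_extension J v $ enum_of J i = v $ i"
  using bij_betw_enum_of[OF assms]
  by (auto simp: zero_extension_def bij_betw_def)

lemma transpose_mult_zero_extension:
  fixes C :: "real^'n^'m" and v :: "real^'n"
  assumes "card J = CARD('n)"
  shows "transpose C *v zero_extension J v = transpose (row_submatrix J C) *v v"
proof (simp add: vec_eq_iff matrix_vector_mult_def transpose_def, intro allI)
  fix l
  have "(\<Sum>j\<in>UNIV. C $ j $ l * zero_extension J v $ j)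
      = (\<Sum>j\<in>J. C $ j $ l * zero_extension J v $ j)"
    by (rule sum.mono_neutral_right) (auto simp: zero_extension_def)
  also have "\<dots> = (\<Sum>i\<in>UNIV. C $ enum_of J i $ l * zero_extension J v $ enum_of J (i::'n))"
    by (rule sum.reindex_bij_betw[symmetric, OF bij_betw_enum_of[OF assms]])
  also have "\<dots> = (\<Sum>i\<in>UNIV. row_submatrix J C $ i $ l * v $ i)"
    by (simp add: zero_extension_nth_enum_of[OF assms] row_submatrix_def)
  finally show "(\<Sum>j\<in>UNIV. C $ j $ l * zero_extension J v $ j)
    = (\<Sum>i\<in>UNIV. row_submatrix J C $ i $ l * v $ i)" .
qed

lemma invertible_row_submatrix:
  fixes C :: "real^'n^'m"
  assumes "card J = CARD('n)" "independent_rows C J"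
  shows "invertible (row_submatrix J C)"
proof -
  have "v = 0" if "transpose (row_submatrix J C) *v v = 0" for v
  proof -
    have "zero_extension J v = 0"
      using assms(2) supp_zero_extension that
      unfolding independent_rows_def transpose_mult_zero_extension[OF assms(1), symmetric]
      by blast
    then show ?thesis
      using zero_extension_nth_enum_of[OF assms(1), of v] by (simp add: vec_eq_iff)
  qed
  then have "invertible (transpose (row_submatrix J C))"
    by (metis invertible_left_inverse matrix_left_invertible_ker)
  then show ?thesis
    by (metis transpose_invertible transpose_transpose)
qed

lemma basic_solution_tight:
  fixes C :: "real^'n^'m"
  assumes "card J = CARD('n)" "invertible (row_submatrix J C)" "j \<in> J"
  shows "(C *v (matrix_inv (row_submatrix J C) *v subvector J d)) $ j = d $ j"
proof -
  let ?x = "matrix_inv (row_submatrix J C) *v subvector J d"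
  obtain i :: 'n where i: "j = enum_of J i"
    using bij_betw_enum_of[OF assms(1)] assms(3) by (auto simp: bij_betw_def)
  have "row_submatrix J C *v ?x = subvector J d"
    using matrix_inv_mult_eq_iff[OF assms(2)] by blast
  then have "(row_submatrix J C *v ?x) $ i = subvector J d $ i"
    by simp
  then show ?thesis
    by (simp add: i row_submatrix_def subvector_def matrix_vector_mult_def)
qed

text \<open>The edge direction of a basis \<open>J\<close> for an entering index \<open>k\<close>: row \<open>k\<close> is a combination of the
  basic rows, and this dependence is unique up to a factor because the basic rows are independent.\<close>

lemma edge_direction:
  fixes C :: "real^'n^'m"
  assumes card: "card J = CARD('n)" and ind: "independent_rows C J" and k: "k \<notin> J"
  obtains u where "transpose C *v u = 0" "supp u \<subseteq> insert k J" "u $ k = 1"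
    "\<And>y. transpose C *v y = 0 \<Longrightarrow> supp y \<subseteq> insert k J \<Longrightarrow> y = y $ k *\<^sub>R u"
proof -
  have "invertible (transpose (row_submatrix J C))"
    using invertible_row_submatrix[OF card ind] by (rule transpose_invertible)
  then obtain v where v: "transpose (row_submatrix J C) *v v = C $ k"
    using matrix_inv_mult_eq_iff by blast
  define u where "u = axis k 1 - zero_extension J v"
  have "transpose C *v axis k 1 = C $ k"
    by (simp add: matrix_vector_mult_basis column_def transpose_def del: transpose_matrix_vector)
  then have ker: "transpose C *v u = 0"
    by (simp add: u_def matrix_vector_mult_diff_distrib transpose_mult_zero_extension[OF card] v
        del: transpose_matrix_vector)
  have sub: "supp u \<subseteq> insert k J"
    using supp_zero_extension[of J v] by (force simp: u_def supp_def axis_def)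
  have uk: "u $ k = 1"
    using k by (simp add: u_def zero_extension_def)
  have "y = y $ k *\<^sub>R u" if y: "transpose C *v y = 0" "supp y \<subseteq> insert k J" for y
  proof -
    have "transpose C *v (y - y $ k *\<^sub>R u) = 0"
      using y(1) ker by (simp add: matrix_vector_mult_diff_distrib matrix_vector_mult_scaleR
          del: transpose_matrix_vector)
    moreover have "supp (y - y $ k *\<^sub>R u) \<subseteq> J"
    proof
      fix j assume j: "j \<in> supp (y - y $ k *\<^sub>R u)"
      then have "j \<noteq> k"
        using uk by (auto simp: supp_def)
      moreover have "j \<in> supp y \<or> j \<in> supp u"
        using j by (auto simp: supp_def)
      ultimately show "j \<in> J"
        using y(2) sub by blast
    qed
    ultimately have "y - y $ k *\<^sub>R u = 0"
      using ind unfolding independent_rows_def by blast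
    then show ?thesis
      by simp
  qed
  then show thesis
    using that ker sub uk by blast
qed

text \<open>A nonnegative edge direction spans an extreme ray: the end points of a segment in the cone
  that meets the ray are supported in \<open>I\<close>, like \<open>u\<close>, and so are multiples of \<open>u\<close>; the factor
  is the \<open>k\<close>-th coordinate, which is nonnegative in the cone.\<close>

lemma nonneg_edge_direction_extreme_ray:
  fixes C :: "real^'n^'m"
  assumes ker: "transpose C *v u = 0" and sub: "supp u \<subseteq> I" and uk: "u $ k = 1" and u0: "0 \<le> u"
    and mult: "\<And>y. transpose C *v y = 0 \<Longrightarrow> supp y \<subseteq> I \<Longrightarrow> y = y $ k *\<^sub>R u"
  shows "ray u \<in> extreme_rays (recession_cone C)"
proof -
  have "ray u \<subseteq> recession_cone C"
    using ker u0 by (auto simp: ray_def recession_cone_def matrix_vector_mult_scaleR less_eq_vec_def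
        simp del: transpose_matrix_vector)
  moreover have "convex (ray u)"
  proof (rule convexI)
    fix x y and p q :: real
    assume x: "x \<in> ray u" and y: "y \<in> ray u" and pq: "0 \<le> p" "0 \<le> q"
    obtain t t' where "x = t *\<^sub>R u" "y = t' *\<^sub>R u" "0 \<le> t" "0 \<le> t'"
      using x y by (auto simp: ray_def)
    then have "p *\<^sub>R x + q *\<^sub>R y = (p * t + q * t') *\<^sub>R u" "0 \<le> p * t + q * t'"
      using pq by (simp_all add: scaleR_add_left)
    then show "p *\<^sub>R x + q *\<^sub>R y \<in> ray u"
      unfolding ray_def by blast
  qed
  moreover have "y \<in> ray u \<and> y' \<in> ray u"
    if y: "y \<in> recession_cone C" and y': "y' \<in> recession_cone C"
      and x: "x \<in> ray u" and seg: "x \<in> open_segment y y'" for x y y'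
  proof -
    have "supp x \<subseteq> I"
      using x sub by (force simp: ray_def supp_def)
    then have "supp y \<subseteq> I" "supp y' \<subseteq> I"
      using supp_subset_of_open_segment[OF _ _ seg] y y' by (auto simp: recession_cone_def)
    then have "y = y $ k *\<^sub>R u" "y' = y' $ k *\<^sub>R u"
      using mult y y' by (auto simp: recession_cone_def)
    moreover have "0 \<le> y $ k" "0 \<le> y' $ k"
      using nth_nonneg y y' by (auto simp: recession_cone_def)
    ultimately show ?thesis
      unfolding ray_def by blast
  qed
  ultimately have "ray u face_of recession_cone C"
    unfolding face_of_def by blast
  moreover have "u \<noteq> 0"
    using uk by auto
  ultimately show ?thesis
    unfolding extreme_rays_def by blast
qed

section \<open>Optimality of the basic solution\<close>

lemma inner_mult_eq_dual:
  fixes C :: "real^'n^'m"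
  shows "(C *v x) \<bullet> z = x \<bullet> (transpose C *v z)"
  by (metis dot_lmul_matrix inner_commute transpose_matrix_vector)

text \<open>One simplex step. A violated row \<open>k\<close> has positive reduced cost \<open>d \<bullet> u\<close> along its edge
  direction \<open>u\<close>, because \<open>d - C x\<close> vanishes on the basis. The adjacent extreme point that the
  ratio test produces is better than \<open>s\<close>, since the step has positive length: all basic
  coordinates of \<open>s\<close> are nonzero.\<close>

lemma basic_solution_feasible:
  fixes C :: "real^'n^'m"
  assumes ext: "s extreme_point_of dual_polyhedron C b"
    and card: "card (supp s) = CARD('n)"
    and max: "\<And>v. v extreme_point_of dual_polyhedron C b \<Longrightarrow> d \<bullet> v \<le> d \<bullet> s"
    and rays: "\<And>r. ray r \<in> extreme_rays (recession_cone C) \<Longrightarrow> d \<bullet> r \<le> 0"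
    and tight: "\<And>j. j \<in> supp s \<Longrightarrow> (C *v x) $ j = d $ j"
  shows "d \<le> C *v x"
proof (rule ccontr)
  assume "\<not> d \<le> C *v x"
  then obtain k where k: "(C *v x) $ k < d $ k"
    by (auto simp: less_eq_vec_def not_le)
  then have kJ: "k \<notin> supp s"
    using tight by fastforce
  have s: "s \<in> dual_polyhedron C b" "0 \<le> s"
    using ext by (auto simp: extreme_point_of_def dual_polyhedron_def)
  have ind: "independent_rows C (supp s)"
    using ext s(1) extreme_point_iff_independent_rows by blast
  obtain u where ker: "transpose C *v u = 0" and sub: "supp u \<subseteq> insert k (supp s)"
    and uk: "u $ k = 1"
    and mult: "\<And>y. transpose C *v y = 0 \<Longrightarrow> supp y \<subseteq> insert k (supp s) \<Longrightarrow> y = y $ k *\<^sub>R u"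
    using edge_direction[OF card ind kJ] by metis
  have gain: "0 < d \<bullet> u"
  proof -
    have "d \<bullet> u = (d - C *v x) \<bullet> u"
      using inner_mult_eq_dual[of C x u] ker by (simp add: inner_diff_left)
    also have "\<dots> = (\<Sum>j\<in>UNIV. (d - C *v x) $ j * u $ j)"
      by (simp add: inner_vec_def)
    also have "\<dots> = (\<Sum>j\<in>{k}. (d - C *v x) $ j * u $ j)"
      by (rule sum.mono_neutral_right) (use sub tight in \<open>auto simp: supp_def\<close>)
    finally show ?thesis
      using k uk by simp
  qed
  show False
  proof (cases "0 \<le> u")
    case True
    then have "ray u \<in> extreme_rays (recession_cone C)"
      using nonneg_edge_direction_extreme_ray[OF ker sub uk] mult by blast
    then show False
      using rays gain by fastforce
  next
    case False
    then obtain t j where t: "0 \<le> t" "0 \<le> s + t *\<^sub>R u" and j: "u $ j < 0" "(s + t *\<^sub>R u) $ j = 0"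
      using ratio_test s(2) by blast
    have "j \<noteq> k"
      using j(1) uk by auto
    moreover have "j \<in> supp u"
      using j(1) by (simp add: supp_def)
    ultimately have "j \<in> supp s"
      using sub by blast
    then have "t \<noteq> 0"
      using j(2) by (auto simp: supp_def)
    have in_Z: "s + t *\<^sub>R u \<in> dual_polyhedron C b"
      using dual_polyhedron_step[OF s(1) ker t(2)] .
    have "y = 0" if y: "transpose C *v y = 0" "supp y \<subseteq> supp (s + t *\<^sub>R u)" for y
    proof -
      have "supp (s + t *\<^sub>R u) \<subseteq> insert k (supp s)"
        using sub by (force simp: supp_def)
      then have yu: "y = y $ k *\<^sub>R u"
        using mult y by blast
      \<comment> \<open>the leaving index \<open>j\<close> excludes the only candidates, the multiples of \<open>u\<close>\<close>
      have "y $ j = 0"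
        using y(2) j(2) by (auto simp: supp_def)
      then have "y $ k * u $ j = 0"
        using yu by (metis real_scaleR_def vector_scaleR_component)
      then show ?thesis
        using j(1) yu by simp
    qed
    then have "independent_rows C (supp (s + t *\<^sub>R u))"
      unfolding independent_rows_def by blast
    then have "s + t *\<^sub>R u extreme_point_of dual_polyhedron C b"
      using in_Z extreme_point_iff_independent_rows by blast
    then have "d \<bullet> (s + t *\<^sub>R u) \<le> d \<bullet> s"
      by (rule max)
    moreover have "0 < t * (d \<bullet> u)"
      using t(1) \<open>t \<noteq> 0\<close> gain by simp
    ultimately show False
      by (simp add: inner_add_right)
  qed
qed

text \<open>Every feasible \<open>y\<close> has \<open>b \<bullet> y = s \<bullet> C y \<ge> s \<bullet> d\<close>, with equality if \<open>C y\<close> agrees with \<open>d\<close> on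
  the support of \<open>s\<close>.\<close>

lemma complementary_imp_optimal:
  fixes C :: "real^'n^'m"
  assumes s: "s \<in> dual_polyhedron C b" and feas: "d \<le> C *v x"
    and tight: "\<And>j. j \<in> supp s \<Longrightarrow> (C *v x) $ j = d $ j"
  shows "is_arg_min (\<lambda>x. b \<bullet> x) (\<lambda>x. d \<le> C *v x) x"
proof -
  have dual: "b \<bullet> y = (C *v y) \<bullet> s" for y
    using s inner_mult_eq_dual[of C y s] by (simp add: dual_polyhedron_def inner_commute)
  have "(C *v x) $ j * s $ j = d $ j * s $ j" for j
    using tight by (cases "j \<in> supp s") (auto simp: supp_def)
  then have "(C *v x) \<bullet> s = d \<bullet> s"
    by (simp only: inner_vec_def inner_real_def)
  then have "b \<bullet> x = d \<bullet> s"
    using dual by simp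
  moreover have "d \<bullet> s \<le> b \<bullet> y" if "d \<le> C *v y" for y
  proof -
    have "0 \<le> s"
      using s by (simp add: dual_polyhedron_def)
    then have "d \<bullet> s \<le> (C *v y) \<bullet> s"
      using that by (auto simp: inner_vec_def less_eq_vec_def intro!: sum_mono mult_right_mono)
    then show ?thesis
      using dual by simp
  qed
  ultimately show ?thesis
    using feas by (auto simp: is_arg_min_linorder)
qed

section \<open>The selected extreme point and the first-stage constraints\<close>

lemma selector_maximizes:
  assumes bij: "bij_betw s {1..n} S" and "S \<noteq> {}"
  shows "s (selector s n S d) \<in> S" "v \<in> S \<Longrightarrow> d \<bullet> v \<le> d \<bullet> s (selector s n S d)"
proof -
  have img: "S = s ` {1..n}"
    using bij by (simp add: bij_betw_def)
  then have "{1..n} \<noteq> {}"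
    using assms(2) by auto
  then obtain i where "i \<in> {1..n}" "\<And>j. j \<in> {1..n} \<Longrightarrow> d \<bullet> s j \<le> d \<bullet> s i"
    using obtains_MAX[of "{1..n}" "\<lambda>j. d \<bullet> s j"]
    by (metis finite_atLeastAtMost Max_ge finite_imageI imageI)
  then have "is_arg_max (\<lambda>j. d \<bullet> s j) (\<lambda>j. j \<in> {1..n} \<and> s j \<in> S) i"
    using img by (auto simp: is_arg_max_linorder)
  then have "is_arg_max (\<lambda>j. d \<bullet> s j) (\<lambda>j. j \<in> {1..n} \<and> s j \<in> S) (selector s n S d)"
    unfolding selector_def by (rule LeastI)
  then show "s (selector s n S d) \<in> S" "v \<in> S \<Longrightarrow> d \<bullet> v \<le> d \<bullet> s (selector s n S d)"
    using img by (auto simp: is_arg_max_linorder)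
qed

text \<open>\<open>R\<close> contains only one generator of each extreme ray, but the sign of \<open>d \<bullet> r\<close> is the same for
  all generators of a ray.\<close>

lemma first_stage_feasible_extreme_ray:
  assumes x1: "x1 \<in> first_stage_feasible \<Xi> R A a W w B"
    and gen: "extreme_ray_generators K R"
    and xi: "\<xi> \<in> \<Xi>" and r: "ray r \<in> extreme_rays K"
  shows "rhs W w B \<xi> x1 \<bullet> r \<le> 0"
proof -
  have "ray r \<in> ray ` R"
    using gen r by (simp add: extreme_ray_generators_def bij_betw_def)
  then obtain r' where r': "r' \<in> R" "ray r' = ray r"
    by (metis imageE)
  have "r \<in> ray r"
    unfolding ray_def by (auto intro!: exI[of _ 1])
  then obtain t where t: "0 \<le> t" "r = t *\<^sub>R r'"
    using r'(2) by (auto simp: ray_def)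
  have "ereal (rhs W w B \<xi> x1 \<bullet> r') \<le> (SUP \<xi>\<in>\<Xi>. ereal (rhs W w B \<xi> x1 \<bullet> r'))"
    using xi by (rule SUP_upper)
  also have "\<dots> \<le> 0"
    using x1 r'(1) by (simp add: first_stage_feasible_def)
  finally have "rhs W w B \<xi> x1 \<bullet> r' \<le> 0"
    by simp
  then show ?thesis
    using t by (simp add: mult_nonneg_nonpos)
qed


theorem proposition1:
  fixes \<Xi> :: "(real^'k) set"
    and C :: "real^'n^'m" and b :: "real^'n"
    and W :: "real^'k^'m" and w :: "real^'m" and B :: "real^'p^'m"
    and A :: "real^'p^'q" and a :: "real^'q" and c :: "real^'p"
    and s :: "nat \<Rightarrow> real^'m" and nS :: nat
    and S R :: "(real^'m) set"
    and \<Theta> :: "(real^'t) set" and L :: nat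
    and \<phi>0 :: "real^'t \<Rightarrow> real" and \<phi> :: "nat \<Rightarrow> real^'t \<Rightarrow> real^'k \<Rightarrow> real"
    and x1 :: "real^'p" and \<theta> :: "real^'t"
  assumes "compact \<Xi>"
    and "CARD('n) \<le> CARD('m)"
    and "dual_polyhedron C b \<noteq> {}"
    and "S = {v. v extreme_point_of dual_polyhedron C b}"
    and "bij_betw s {1..nS} S"
    and "extreme_ray_generators (recession_cone C) R"
    and "rank C = CARD('n)"
    and "\<forall>v\<in>S. card (supp v) = CARD('n)"
    and "is_arg_min (master_objective c \<phi>0)
           (\<lambda>y. y \<in> master_feasible \<Xi> S R A a W w B \<Theta> L \<phi>) (x1, \<theta>)"
  shows "\<forall>\<xi>\<in>\<Xi>.
    let d = rhs W w B \<xi> x1;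
        J = supp (s (selector s nS S d));
        x2 = matrix_inv (row_submatrix J C) *v subvector J d
    in invertible (row_submatrix J C) \<and>
       is_arg_min (\<lambda>x. b \<bullet> x) (\<lambda>x. d \<le> C *v x) x2"
proof
  fix \<xi> assume xi: "\<xi> \<in> \<Xi>"
  define d where "d = rhs W w B \<xi> x1"
  define v where "v = s (selector s nS S d)"
  define x2 where "x2 = matrix_inv (row_submatrix (supp v) C) *v subvector (supp v) d"
  have "S \<noteq> {}"
    using extreme_point_exists assms(3,4) by auto
  then have "v \<in> S" and max: "\<And>y. y \<in> S \<Longrightarrow> d \<bullet> y \<le> d \<bullet> v"
    using selector_maximizes[OF assms(5)] by (simp_all add: v_def)
  then have ext: "v extreme_point_of dual_polyhedron C b" and card: "card (supp v) = CARD('n)"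
    using assms(4,8) by auto
  have v: "v \<in> dual_polyhedron C b"
    using ext by (simp add: extreme_point_of_def)
  have inv: "invertible (row_submatrix (supp v) C)"
    using card ext extreme_point_iff_independent_rows[OF v] invertible_row_submatrix by blast
  have tight: "(C *v x2) $ j = d $ j" if "j \<in> supp v" for j
    unfolding x2_def using card inv that by (rule basic_solution_tight)
  have "x1 \<in> first_stage_feasible \<Xi> R A a W w B"
    using assms(9) by (simp add: is_arg_min_def master_feasible_def)
  then have rays: "d \<bullet> r \<le> 0" if "ray r \<in> extreme_rays (recession_cone C)" for r
    unfolding d_def using assms(6) xi that by (rule first_stage_feasible_extreme_ray)
  have "d \<le> C *v x2"
    by (rule basic_solution_feasible[OF ext card]) (use max rays tight assms(4) in auto)
  then have "is_arg_min (\<lambda>x. b \<bullet> x) (\<lambda>x. d \<le> C *v x) x2"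
    using complementary_imp_optimal v tight by blast
  then show "let d = rhs W w B \<xi> x1;
        J = supp (s (selector s nS S d));
        x2 = matrix_inv (row_submatrix J C) *v subvector J d
    in invertible (row_submatrix J C) \<and>
       is_arg_min (\<lambda>x. b \<bullet> x) (\<lambda>x. d \<le> C *v x) x2"
    using inv unfolding Let_def d_def[symmetric] v_def[symmetric] x2_def[symmetric] by blast
qed

end
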